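(* Let $n\geq 3$ and let $q$ be a prime power. Suppose that $\mathcal{L}$ is a Cameron-Liebler line class in $\mathrm{AG}(n,q)$ with parameter $x$. Then $$x(x-1)\frac{q^{n-2}-1}{q-1}\equiv 0 \pmod{2(q+1)}.$$
   Context: A line spread of the affine space $\mathrm{AG}(n,q)$ is a set of lines of $\mathrm{AG}(n,q)$ partitioning its point set. A Cameron-Liebler line class with parameter $x$ in $\mathrm{AG}(n,q)$ is a set $\mathcal{L}$ of lines of $\mathrm{AG}(n,q)$ such that $|\mathcal{L}\cap\mathcal{S}|=x$ for every line spread $\mathcal{S}$ of $\mathrm{AG}(n,q)$. *)

theory Defs
  imports "HOL-Analysis.Cartesian_Space" "HOL-Library.Disjoint_Sets" "HOL-Number_Theory.Cong"
begin

text \<open>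
  The points of AG(n,q) are the vectors of type 'a ^ 'n, where 'a is a finite field
  with CARD('a) = q and CARD('n) = n. Lines are the cosets of one-dimensional subspaces.
\<close>

definition ag_lines :: "('a::{field,finite} ^ 'n) set set" where
  "ag_lines = {range (\<lambda>t. p + t *s v) | p v. v \<noteq> 0}"

definition line_spread :: "('a::{field,finite} ^ 'n) set set \<Rightarrow> bool" where
  "line_spread S \<longleftrightarrow> S \<subseteq> ag_lines \<and> partition_on UNIV S"

definition cameron_liebler :: "nat \<Rightarrow> ('a::{field,finite} ^ 'n) set set \<Rightarrow> bool" where
  "cameron_liebler x L \<longleftrightarrow>
     L \<subseteq> ag_lines \<and> (\<forall>S. line_spread S \<longrightarrow> card (L \<inter> S) = x)"

end

theory Submission imports Defs begin

text \<open>
  Switching a parallel class of lines inside one plane to another parallel class of that plane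
  turns a spread into a spread. Hence in every plane all directions contain equally many lines
  of L. If d(p) is the number of lines of L through p, it follows that the sum of d over a line l
  is an affine function of the indicator of l in L, and then, by summing over the lines
  of a plane through p, that d(p) = x + \<theta> e(p) with \<theta> = (q^(n-1) - 1)/(q - 1) and e(p) an
  integer. The sum of e over a line is q times the indicator of that line; computing the sum
  of e(p) d(p) in two ways gives the sum of the squares of e, which is congruent modulo 2 to the
  sum of e, namely q x. For odd n this yields the claim, since then q + 1 divides \<theta>; for even n
  the factor (q^(n-2) - 1)/(q - 1) is itself divisible by q + 1.
\<close>

section \<open>Lines of the affine space and reindexing of sums\<close>

definition aline :: "'a::{field,finite} ^ 'n \<Rightarrow> 'a ^ 'n \<Rightarrow> ('a ^ 'n) set" where
  "aline p v = range (\<lambda>t. p + t *s v)"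

lemma aline_in_ag_lines: "v \<noteq> 0 \<Longrightarrow> aline p v \<in> ag_lines"
  by (auto simp: ag_lines_def aline_def)

lemma mem_aline_self: "p \<in> aline p v"
  unfolding aline_def by (rule range_eqI[of _ _ 0]) simp

lemma aline_shift: "aline (p + t *s v) v = aline p v"
proof -
  have "range (\<lambda>s. p + t *s v + s *s v) = (\<lambda>s. p + s *s v) ` range (\<lambda>s. t + s)"
    by (simp only: image_image vec.scale_left_distrib add.assoc)
  also have "range (\<lambda>s. t + s) = UNIV"
    by (rule surj_plus)
  finally show ?thesis
    by (simp add: aline_def)
qed

lemma aline_scale:
  assumes "c \<noteq> 0"
  shows "aline p (c *s v) = aline p v"
proof -
  have "range (\<lambda>s. p + s *s (c *s v)) = (\<lambda>s. p + s *s v) ` range (\<lambda>s. s * c)"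
    by (simp add: image_image)
  also have "range (\<lambda>s. s * c) = UNIV"
    using assms by (auto intro!: range_eqI[of _ _ "_ / c"])
  finally show ?thesis
    by (simp add: aline_def)
qed

lemma card_aline:
  fixes p v :: "'a::{field,finite} ^ 'n"
  assumes "v \<noteq> 0"
  shows "card (aline p v) = CARD('a)"
  unfolding aline_def using assms
  by (intro card_image) (auto simp: inj_on_def)

lemma card_field_ge_2: "CARD('a::{field,finite}) \<ge> 2"
proof -
  have "card {0, 1::'a} \<le> CARD('a)" by (intro card_mono) auto
  then show ?thesis by simp
qed

lemma sum_shift:
  fixes f :: "'b::{ab_group_add,finite} \<Rightarrow> int"
  shows "(\<Sum>p\<in>UNIV. f (p + c)) = (\<Sum>p\<in>UNIV. f p)"
  by (rule sum.reindex_bij_witness[of _ "\<lambda>p. p - c" "\<lambda>p. p + c"]) auto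

lemma sum_nonzero_scale:
  fixes f :: "'a::{field,finite} ^ 'n \<Rightarrow> int"
  assumes "c \<noteq> 0"
  shows "(\<Sum>w\<in>-{0}. f (c *s w)) = (\<Sum>w\<in>-{0}. f w)"
  using assms
  by (intro sum.reindex_bij_witness[of _ "\<lambda>w. inverse c *s w" "\<lambda>w. c *s w"]) auto

lemma sum_remove_zero:
  fixes f :: "'b::{zero,finite} \<Rightarrow> int"
  shows "(\<Sum>t\<in>UNIV. f t) = f 0 + (\<Sum>t\<in>-{0}. f t)"
  by (simp add: sum.remove[of UNIV 0] Compl_eq_Diff_UNIV)

text \<open>By \<open>const\<close>, every point of \<open>aline r (u r)\<close> is assigned that
  same line, so two lines that meet coincide. Spreads can thus be given by choosing a direction at
  each point.\<close>

lemma line_spread_field: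
  fixes u :: "'a::{field,finite} ^ 'n \<Rightarrow> 'a ^ 'n"
  assumes nz: "\<And>r. u r \<noteq> 0" and const: "\<And>r t. u (r + t *s u r) = u r"
  shows "line_spread (range (\<lambda>r. aline r (u r)))"
proof -
  have same: "aline s (u s) = aline r (u r)" if "s \<in> aline r (u r)" for r s
  proof -
    from that obtain t where s: "s = r + t *s u r"
      by (auto simp: aline_def)
    show ?thesis
      unfolding s const by (rule aline_shift)
  qed
  have "disjoint (range (\<lambda>r. aline r (u r)))"
    unfolding disjoint_def using same by blast
  moreover have "\<Union> (range (\<lambda>r. aline r (u r))) = UNIV"
    using mem_aline_self by auto
  moreover have "{} \<notin> range (\<lambda>r. aline r (u r))"
    using mem_aline_self by blast
  ultimately show ?thesis
    using nz by (auto simp: line_spread_def partition_on_def intro: aline_in_ag_lines)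
qed

section \<open>Counting the lines of a Cameron-Liebler class\<close>

locale cl_class =
  fixes L :: "('a::{field,finite} ^ 'n) set set" and x :: nat and q :: int
  assumes CL: "cameron_liebler x L" and card_field [simp]: "int CARD('a) = q"
begin

definition g :: "'a ^ 'n \<Rightarrow> 'a ^ 'n \<Rightarrow> int" where
  "g v p = of_bool (aline p v \<in> L)"

text \<open>Summing over nonzero vectors counts every line through p exactly q - 1 times.\<close>

definition D :: "'a ^ 'n \<Rightarrow> int" where
  "D p = (\<Sum>v\<in>-{0}. g v p)"

lemma q_ge_2: "q \<ge> 2"
  using card_field_ge_2[where 'a='a] card_field by linarith

lemma g_shift: "g v (p + t *s v) = g v p"
  by (simp add: g_def aline_shift)

lemma g_scale: "c \<noteq> 0 \<Longrightarrow> g (c *s v) p = g v p"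
  by (simp add: g_def aline_scale)

lemma g_idem: "g v p * g v p = g v p"
  by (simp add: g_def)

text \<open>Points are counted instead of lines: the x lines of L in the spread are disjoint and
  have q points each.\<close>

lemma sum_direction_field:
  assumes nz: "\<And>r. u r \<noteq> 0" and const: "\<And>r t. u (r + t *s u r) = u r"
  shows "(\<Sum>r\<in>UNIV. g (u r) r) = q * int x"
proof -
  define S where "S = range (\<lambda>r. aline r (u r))"
  have S: "line_spread S"
    unfolding S_def using assms by (rule line_spread_field)
  then have dis: "disjoint (L \<inter> S)" and cS: "card (L \<inter> S) = x"
    using CL by (auto simp: line_spread_def partition_on_def cameron_liebler_def disjoint_def)
  have "{r. aline r (u r) \<in> L} = \<Union> (L \<inter> S)"
  proof
    show "{r. aline r (u r) \<in> L} \<subseteq> \<Union> (L \<inter> S)"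
      using mem_aline_self by (auto simp: S_def)
    show "\<Union> (L \<inter> S) \<subseteq> {r. aline r (u r) \<in> L}"
    proof
      fix s assume "s \<in> \<Union> (L \<inter> S)"
      then obtain r where r: "aline r (u r) \<in> L" "s \<in> aline r (u r)"
        by (auto simp: S_def)
      then obtain t where "s = r + t *s u r"
        by (auto simp: aline_def)
      then show "s \<in> {r. aline r (u r) \<in> L}"
        using r(1) by (simp add: const aline_shift)
    qed
  qed
  moreover have "card (\<Union> (L \<inter> S)) = (\<Sum>l\<in>L \<inter> S. card l)"
    using dis by (intro card_Union_disjoint) auto
  moreover have "card l = CARD('a)" if "l \<in> L \<inter> S" for l
    using that nz card_aline by (auto simp: S_def)
  ultimately have "card {r. aline r (u r) \<in> L} = x * CARD('a)"
    using cS by simp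
  then show ?thesis
    by (simp add: g_def of_bool_def sum.If_cases mult.commute)
qed

lemma sum_parallel: "v \<noteq> 0 \<Longrightarrow> (\<Sum>r\<in>UNIV. g v r) = q * int x"
  using sum_direction_field[of "\<lambda>_. v"] by simp

text \<open>The plane through p spanned by v and w is switched from direction v to direction w.\<close>

lemma sum_switch_independent:
  assumes "v \<noteq> 0" and indep: "w \<notin> range (\<lambda>c. c *s v)"
  shows "(\<Sum>s\<in>UNIV. g w (p + s *s v)) = (\<Sum>t\<in>UNIV. g v (p + t *s w))"
proof -
  define f where "f = (\<lambda>(s, t). p + s *s v + t *s w)"
  define P where "P = range f"
  define u where "u = (\<lambda>r. if r \<in> P then w else v)"
  have w0: "w \<noteq> 0"
    using indep by (metis rangeI vector_smult_lzero)
  have inj: "inj f"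
  proof (rule injI, clarify)
    fix s t s' t' assume "f (s, t) = f (s', t')"
    then have eq: "(t - t') *s w = (s' - s) *s v"
      by (simp add: f_def algebra_simps vec.scale_left_diff_distrib)
    have "t = t'"
    proof (rule ccontr)
      assume "t \<noteq> t'"
      then have "w = (inverse (t - t') * (s' - s)) *s v"
        using arg_cong[OF eq, of "\<lambda>y. inverse (t - t') *s y"] by simp
      with indep show False by blast
    qed
    with eq assms(1) show "s = s' \<and> t = t'" by simp
  qed
  have memP: "f (s, t) \<in> P" for s t
    by (simp add: P_def)
  have addv: "r + c *s v \<in> P" if "r \<in> P" for r c
  proof -
    from that obtain s t where "r = f (s, t)" by (auto simp: P_def)
    then have "r + c *s v = f (s + c, t)"
      by (simp add: f_def vec.scale_left_distrib)
    then show ?thesis by (simp add: memP)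
  qed
  have addw: "r + c *s w \<in> P" if "r \<in> P" for r c
  proof -
    from that obtain s t where "r = f (s, t)" by (auto simp: P_def)
    then have "r + c *s w = f (s, t + c)"
      by (simp add: f_def vec.scale_left_distrib add.assoc)
    then show ?thesis by (simp add: memP)
  qed
  \<comment> \<open>Contrapositively, a line in direction \<open>v\<close> that starts outside
    \<open>P\<close> never enters \<open>P\<close>, so \<open>u\<close> is constant along
    it.\<close>
  have subv: "r \<in> P" if "r + c *s v \<in> P" for r c
    using addv[OF that, of "- c"] by simp
  have "(\<Sum>r\<in>UNIV. g (u r) r) = q * int x"
  proof (rule sum_direction_field)
    show "u r \<noteq> 0" for r
      using assms(1) w0 by (simp add: u_def)
    show "u (r + t *s u r) = u r" for r t
      using addw[of r t] subv[of r t] by (cases "r \<in> P") (auto simp: u_def)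
  qed
  also have "\<dots> = (\<Sum>r\<in>UNIV. g v r)"
    using sum_parallel[OF assms(1)] by simp
  finally have "(\<Sum>r\<in>P. g (u r) r) + (\<Sum>r\<in>-P. g (u r) r) = (\<Sum>r\<in>P. g v r) + (\<Sum>r\<in>-P. g v r)"
    by (simp flip: sum.union_disjoint)
  \<comment> \<open>Outside \<open>P\<close> the switched and the parallel field agree, so only the
    plane remains.\<close>
  moreover have "(\<Sum>r\<in>-P. g (u r) r) = (\<Sum>r\<in>-P. g v r)"
    and "(\<Sum>r\<in>P. g (u r) r) = (\<Sum>r\<in>P. g w r)"
    by (auto simp: u_def intro: sum.cong)
  ultimately have "(\<Sum>r\<in>P. g w r) = (\<Sum>r\<in>P. g v r)"
    by simp
  moreover have "(\<Sum>r\<in>P. h r) = (\<Sum>s\<in>UNIV. \<Sum>t\<in>UNIV. h (f (s, t)))" for h :: "_ \<Rightarrow> int"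
    unfolding P_def sum.reindex[OF inj] by (simp add: sum.cartesian_product)
  moreover have "g w (f (s, t)) = g w (p + s *s v)" for s t
    by (simp add: f_def g_shift)
  moreover have "g v (f (s, t)) = g v (p + t *s w)" for s t
    using g_shift[of v "p + t *s w" s] by (simp add: f_def algebra_simps)
  \<comment> \<open>Each line is counted once per point, whence the factor q on both sides.\<close>
  ultimately have "q * (\<Sum>s\<in>UNIV. g w (p + s *s v)) = q * (\<Sum>t\<in>UNIV. g v (p + t *s w))"
    by (simp flip: sum_distrib_left)
  then show ?thesis using q_ge_2 by simp
qed

text \<open>For \<open>w\<close> a multiple of \<open>v\<close>, all terms on both sides equal
  \<open>g v p\<close>. Covering this case allows summation over every nonzero
  \<open>w\<close>.\<close>

lemma sum_switch:
  assumes "v \<noteq> 0" "w \<noteq> 0"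
  shows "(\<Sum>s\<in>UNIV. g w (p + s *s v)) = (\<Sum>t\<in>UNIV. g v (p + t *s w))"
proof (cases "w \<in> range (\<lambda>c. c *s v)")
  case True
  then obtain c where w: "w = c *s v" and c: "c \<noteq> 0"
    using assms(2) by auto
  have "g w (p + s *s v) = g v p" for s
    by (simp add: w g_scale[OF c] g_shift)
  moreover have "g v (p + t *s w) = g v p" for t
    using g_shift[of v p "t * c"] by (simp add: w)
  ultimately show ?thesis by simp
qed (use assms sum_switch_independent in blast)

text \<open>After \<open>sum_switch\<close> only lines in direction \<open>v\<close> are counted.
  The summand t = 0 gives \<open>g v p\<close> for each nonzero \<open>w\<close>; for any other t
  the points \<open>p + t *s w\<close> run through all points except p.\<close>

lemma sum_D_line:
  assumes "v \<noteq> 0"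
  shows "(\<Sum>s\<in>UNIV. D (p + s *s v)) = (q - 1) * q * int x + (q ^ CARD('n) - q) * g v p"
proof -
  have cardnz: "int (card (- {0::'a})) = q - 1" "int (card (- {0::'a ^ 'n})) = q ^ CARD('n) - 1"
    by (simp_all add: Compl_eq_Diff_UNIV card_Diff_singleton of_nat_diff Suc_leI)
  have "(\<Sum>w\<in>-{0}. g v (p + w)) = q * int x - g v p"
    using sum_remove_zero[of "\<lambda>w. g v (p + w)"] sum_shift[of "g v" p] sum_parallel[OF assms]
    by (simp add: add.commute)
  then have inner: "(\<Sum>w\<in>-{0}. g v (p + t *s w)) = q * int x - g v p" if "t \<noteq> 0" for t
    using sum_nonzero_scale[OF that, of "\<lambda>w. g v (p + w)"] by simp
  have "(\<Sum>s\<in>UNIV. D (p + s *s v)) = (\<Sum>w\<in>-{0}. \<Sum>s\<in>UNIV. g w (p + s *s v))"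
    unfolding D_def by (rule sum.swap)
  also have "\<dots> = (\<Sum>w\<in>-{0}. \<Sum>t\<in>UNIV. g v (p + t *s w))"
    using assms by (intro sum.cong refl sum_switch) auto
  also have "\<dots> = (\<Sum>t\<in>UNIV. \<Sum>w\<in>-{0}. g v (p + t *s w))"
    by (rule sum.swap)
  also have "\<dots> = (q ^ CARD('n) - 1) * g v p + (q - 1) * (q * int x - g v p)"
    unfolding sum_remove_zero[of "\<lambda>t. \<Sum>w\<in>-{0}. g v (p + t *s w)"]
    using inner cardnz by simp
  finally show ?thesis
    by (simp add: algebra_simps)
qed

text \<open>
  In the plane through p spanned by v and w, e p is the number of lines of L through p
  minus the number of lines of L in any one parallel class.
\<close>

lemma D_eq:
  assumes "v \<noteq> 0" "w \<notin> range (\<lambda>c. c *s v)" "v \<notin> range (\<lambda>c. c *s w)"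
  defines "e \<equiv> \<lambda>p. g w p + (\<Sum>t\<in>UNIV. g (v + t *s w) p) - (\<Sum>t\<in>UNIV. g v (p + t *s w))"
  shows "q * D p = (q - 1) * q * int x + (q ^ CARD('n) - q) * e p"
proof -
  have w0: "w \<noteq> 0"
    using assms(2) by (metis rangeI vector_smult_lzero)
  have vt: "v + t *s w \<noteq> 0" for t
  proof
    assume "v + t *s w = 0"
    then have "v = (- t) *s w" by (simp add: eq_neg_iff_add_eq_0)
    with assms(3) show False by blast
  qed
  \<comment> \<open>For s \<noteq> 0 both sides run over the line through \<open>p + s *s v\<close>
    parallel to \<open>w\<close>.\<close>
  have row: "(\<Sum>t\<in>UNIV. D (p + s *s (v + t *s w))) = (\<Sum>t\<in>UNIV. D (p + s *s v + t *s w))"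
    if "s \<noteq> 0" for s
    using that
    by (intro sum.reindex_bij_witness[of _ "\<lambda>t. inverse s * t" "\<lambda>t. s * t"])
       (auto simp: vec.scale_right_distrib add.assoc)
  \<comment> \<open>The q + 1 lines through p in the plane cover p exactly q + 1 times and every
    other point once, so their total exceeds the sum of \<open>D\<close> over the plane by
    \<open>q * D p\<close>. The plane sum is then taken along the q lines parallel to
    \<open>v\<close>.\<close>
  have "(\<Sum>s\<in>UNIV. D (p + s *s w)) + (\<Sum>t\<in>UNIV. \<Sum>s\<in>UNIV. D (p + s *s (v + t *s w)))
      = (\<Sum>s\<in>UNIV. D (p + s *s w)) + (\<Sum>s\<in>UNIV. \<Sum>t\<in>UNIV. D (p + s *s (v + t *s w)))"
    by (subst sum.swap) simp
  also have "\<dots> = q * D p + (\<Sum>s\<in>UNIV. \<Sum>t\<in>UNIV. D (p + s *s v + t *s w))"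
    unfolding sum_remove_zero[of "\<lambda>s. \<Sum>t\<in>UNIV. D (p + s *s (v + t *s w))"]
      sum_remove_zero[of "\<lambda>s. \<Sum>t\<in>UNIV. D (p + s *s v + t *s w)"]
    using row by simp
  also have "(\<Sum>s\<in>UNIV. \<Sum>t\<in>UNIV. D (p + s *s v + t *s w))
      = (\<Sum>t\<in>UNIV. \<Sum>s\<in>UNIV. D (p + t *s w + s *s v))"
    by (subst sum.swap) (simp add: algebra_simps)
  finally have "q * D p + q * ((q - 1) * q * int x) + (q ^ CARD('n) - q) * (\<Sum>t\<in>UNIV. g v (p + t *s w))
      = (q + 1) * ((q - 1) * q * int x) + (q ^ CARD('n) - q) * (g w p + (\<Sum>t\<in>UNIV. g (v + t *s w) p))"
    using assms(1) w0 vt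
    by (simp add: sum_D_line sum.distrib distrib_left distrib_right flip: sum_distrib_left)
  then show ?thesis
    by (simp add: e_def algebra_simps)
qed

end

section \<open>The sum of the squares of e\<close>

lemma even_sum_squares_diff: "even ((\<Sum>p\<in>A. f p * f p) - (\<Sum>p\<in>A. f p :: int))"
  by (simp add: dvd_sum flip: sum_subtractf)

text \<open>The integer k is half the difference between the sums of \<open>e p * e p\<close> and
  \<open>e p\<close>; it carries the parity information behind the factor 2 in the modulus.\<close>

lemma (in cl_class) sum_squares_identity:
  assumes n: "CARD('n) \<ge> 2"
  shows "\<exists>k. (q ^ (CARD('n) - 1) - 1) * (q * int x + 2 * k)
           = q * int x * (q ^ CARD('n) - 1 - (q - 1) * int x)"
proof -
  obtain i j :: 'n where ij: "i \<noteq> j"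
    using n by (metis card_2_iff' card_le_Suc0_iff_eq finite UNIV_I not_less_eq_eq numeral_2_eq_2)
  define v w :: "'a ^ 'n" where "v = axis i 1" and "w = axis j 1"
  have v0: "v \<noteq> 0"
    by (simp add: v_def)
  have wv: "w \<notin> range (\<lambda>c. c *s v)" and vw: "v \<notin> range (\<lambda>c. c *s w)"
    using ij by (auto simp: v_def w_def vec_eq_iff axis_def split: if_splits)
  define e where
    "e = (\<lambda>p. g w p + (\<Sum>t\<in>UNIV. g (v + t *s w) p) - (\<Sum>t\<in>UNIV. g v (p + t *s w)))"
  \<comment> \<open>\<open>K\<close> is (q - 1) \<theta>, since \<open>D\<close> is q - 1 times the
    number of lines of L through a point.\<close>
  define K where "K = q ^ (CARD('n) - 1) - 1"
  have q0: "q \<noteq> 0" using q_ge_2 by simp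
  have "q ^ 0 < q ^ (CARD('n) - 1)"
    using q_ge_2 n by (intro power_strict_increasing) auto
  then have K0: "K \<noteq> 0" by (simp add: K_def)
  have Q: "q ^ CARD('n) = q * K + q"
    using n by (simp add: K_def algebra_simps flip: power_Suc)
  have D: "D p = (q - 1) * int x + K * e p" for p
  proof -
    have "q * D p = q * ((q - 1) * int x + K * e p)"
      using D_eq[OF v0 wv vw, of p] unfolding Q e_def by (simp add: algebra_simps)
    with q0 show ?thesis by simp
  qed
  \<comment> \<open>Although \<open>e\<close> is built from one plane, \<open>D\<close> determines
    it, so \<open>sum_D_line\<close> applies in every direction \<open>u\<close>.\<close>
  have line: "(\<Sum>s\<in>UNIV. e (p + s *s u)) = q * g u p" if "u \<noteq> 0" for u p
  proof -
    have "K * (\<Sum>s\<in>UNIV. e (p + s *s u)) = K * (q * g u p)"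
      using sum_D_line[OF that, of p] unfolding Q D
      by (simp add: sum.distrib sum_subtractf algebra_simps flip: sum_distrib_left)
    with K0 show ?thesis by simp
  qed
  have avg: "(\<Sum>p\<in>UNIV. \<Sum>s\<in>UNIV. h (p + s *s u)) = q * (\<Sum>p\<in>UNIV. h p)"
    for h :: "'a ^ 'n \<Rightarrow> int" and u
    by (subst sum.swap) (simp add: sum_shift)
  have "q * (\<Sum>p\<in>UNIV. e p) = q * (q * int x)"
    unfolding avg[symmetric, of _ v] line[OF v0]
    by (simp add: sum_parallel[OF v0] flip: sum_distrib_left)
  with q0 have sum_e: "(\<Sum>p\<in>UNIV. e p) = q * int x" by simp
  have sum_eg: "(\<Sum>p\<in>UNIV. e p * g u p) = q * int x" if "u \<noteq> 0" for u
  proof -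
    \<comment> \<open>\<open>g u\<close> is constant along lines in direction \<open>u\<close>, so
      \<open>e\<close> may be replaced by its line sum \<open>q * g u p\<close>, and
      \<open>g\<close> is idempotent.\<close>
    have "q * (\<Sum>p\<in>UNIV. e p * g u p) = (\<Sum>p\<in>UNIV. (\<Sum>s\<in>UNIV. e (p + s *s u)) * g u p)"
      unfolding avg[symmetric, of _ u] by (simp add: g_shift sum_distrib_right)
    also have "\<dots> = q * (q * int x)"
      using that
      by (simp add: line mult.assoc g_idem sum_parallel flip: sum_distrib_left)
    finally show ?thesis using q0 by simp
  qed
  have cardnz: "int (card (- {0::'a ^ 'n})) = q ^ CARD('n) - 1"
    by (simp add: Compl_eq_Diff_UNIV card_Diff_singleton of_nat_diff Suc_leI)
  have "(\<Sum>p\<in>UNIV. e p * D p) = (\<Sum>u\<in>-{0}. \<Sum>p\<in>UNIV. e p * g u p)"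
    unfolding D_def sum_distrib_left by (rule sum.swap)
  also have "\<dots> = (q ^ CARD('n) - 1) * (q * int x)"
    using cardnz by (simp add: sum_eg)
  finally have "(q ^ CARD('n) - 1) * (q * int x)
      = (q - 1) * int x * (\<Sum>p\<in>UNIV. e p) + K * (\<Sum>p\<in>UNIV. e p * e p)"
    unfolding D by (simp add: algebra_simps sum.distrib sum_subtractf flip: sum_distrib_left)
  then have "K * (\<Sum>p\<in>UNIV. e p * e p) = q * int x * (q ^ CARD('n) - 1 - (q - 1) * int x)"
    unfolding sum_e by (simp add: algebra_simps)
  moreover obtain k where "(\<Sum>p\<in>UNIV. e p * e p) - (\<Sum>p\<in>UNIV. e p) = 2 * k"
    using even_sum_squares_diff[of e UNIV] by (elim evenE)
  then have "(\<Sum>p\<in>UNIV. e p * e p) = q * int x + 2 * k"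
    using sum_e by simp
  ultimately show ?thesis
    unfolding K_def by auto
qed

section \<open>Divisibility by 2(q + 1)\<close>

lemma square_minus_one_dvd_power: "q\<^sup>2 - 1 dvd q ^ (2 * m) - (1::int)"
  using power_diff_1_eq[of "q\<^sup>2" m] by (simp add: power_mult)

theorem theorem3p1:
  fixes L :: "('a::{field,finite} ^ 'n) set set" and n q x :: nat
  assumes "CARD('n) = n" and "n \<ge> 3"
    and "CARD('a) = q"
    and "cameron_liebler x L"
  shows "[int x * (int x - 1) * ((int q ^ (n - 2) - 1) div (int q - 1)) = 0] (mod (2 * (int q + 1)))"
proof -
  interpret cl_class L x "int q"
    using assms(3,4) by unfold_locales simp_all
  define Q X where "Q = int q" and "X = int x"
  have Q2: "Q \<ge> 2"
    unfolding Q_def by (rule q_ge_2)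
  have evX: "even (X * (X - 1))" by simp
  have "2 * (Q + 1) dvd X * (X - 1) * ((Q ^ (n - 2) - 1) div (Q - 1))"
  proof (cases "even n")
    case True
    then have "even (n - 2)" by simp
    then obtain m where m: "n - 2 = 2 * m" by (elim evenE)
    obtain c where "Q ^ (n - 2) - 1 = (Q\<^sup>2 - 1) * c"
      using square_minus_one_dvd_power[of Q m] unfolding m by (elim dvdE)
    then have "Q ^ (n - 2) - 1 = (Q - 1) * ((Q + 1) * c)"
      by (simp add: power2_eq_square algebra_simps)
    then have "(Q ^ (n - 2) - 1) div (Q - 1) = (Q + 1) * c"
      using Q2 by simp
    moreover have "2 * (Q + 1) dvd X * (X - 1) * ((Q + 1) * c)"
      using evX by (intro mult_dvd_mono) auto
    ultimately show ?thesis by simp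
  next
    case False
    then obtain m where m: "n = 2 * m + 1" by (elim oddE)
    obtain c where c: "Q ^ (n - 1) - 1 = (Q\<^sup>2 - 1) * c"
      using square_minus_one_dvd_power[of Q m] unfolding m by (auto elim: dvdE)
    have pw: "Q ^ n = Q * Q ^ (n - 1)"
      using assms(2) by (simp flip: power_Suc)
    obtain k where "(Q ^ (n - 1) - 1) * (Q * X + 2 * k) = Q * X * (Q ^ n - 1 - (Q - 1) * X)"
      using sum_squares_identity assms by (auto simp: Q_def X_def)
    moreover have "Q ^ n - 1 = Q * ((Q\<^sup>2 - 1) * c) + (Q - 1)"
      unfolding pw c[symmetric] by (simp add: algebra_simps)
    ultimately have "(Q - 1) * ((Q + 1) * c * (Q * X + 2 * k))
        = (Q - 1) * (Q * X * (Q * ((Q + 1) * c) + 1 - X))"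
      unfolding c by (simp add: power2_eq_square algebra_simps)
    then have "(Q + 1) * c * (Q * X + 2 * k) = Q * X * (Q * ((Q + 1) * c) + 1 - X)"
      using Q2 by simp
    then have "Q * (X * (X - 1)) = (Q + 1) * (c * (Q * (Q - 1) * X - 2 * k))"
      by (simp add: algebra_simps)
    \<comment> \<open>\<open>Q * (Q - 1)\<close> is a product of consecutive integers.\<close>
    moreover have "even (c * (Q * (Q - 1) * X - 2 * k))"
      by simp
    ultimately have dvd: "(Q + 1) * 2 dvd Q * (X * (X - 1))"
      by (simp only: mult_dvd_mono dvd_refl)
    have cop: "coprime (Q + 1) Q" by simp
    \<comment> \<open>The factor Q must be cancelled. For odd Q it is coprime to 2(Q + 1); for even
      Q only Q + 1 survives the cancellation, and the factor 2 comes from X(X - 1).\<close>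
    have "2 * (Q + 1) dvd X * (X - 1)"
    proof (cases "even Q")
      case True
      then have "coprime 2 (Q + 1)" by simp
      moreover have "Q + 1 dvd X * (X - 1)"
        using dvd cop by (meson coprime_dvd_mult_right_iff dvd_mult_left)
      ultimately show ?thesis using evX by (intro divides_mult)
    next
      case False
      then have "coprime 2 Q" by simp
      with cop have "coprime ((Q + 1) * 2) Q"
        by (simp only: coprime_mult_left_iff)
      then show ?thesis
        using dvd by (simp add: coprime_dvd_mult_right_iff mult.commute)
    qed
    then show ?thesis by (rule dvd_mult2)
  qed
  then show ?thesis
    by (simp add: cong_0_iff Q_def X_def)
qed

end
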